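(* Let $\boldsymbol{k}_1,\ldots,\boldsymbol{k}_N\in\mathbb{R}^N$ be wavevectors of the same length, $\mathsf{K} = [\boldsymbol{k}_1,\ldots,\boldsymbol{k}_N]\in\mathbb{R}^{N\times N}$, let $\mathsf{A}$ be a Hermitian $(N+1)\times(N+1)$ matrix, and let $\boldsymbol{u}\in\mathbb{C}^{2N}$. Let $\psi(\boldsymbol{x};\boldsymbol{u}) = \boldsymbol{u}^*\mathsf{Q}(\boldsymbol{x})\boldsymbol{u}$ be the associated acoustic radiation potential, with $\mathsf{Q}(\boldsymbol{x})$ the $2N\times 2N$ Hermitian matrix defined in the context. Then for every $\boldsymbol{x}_0\in\mathbb{R}^N$ the gradient and Hessian of $\psi(\cdot;\boldsymbol{u})$ at $\boldsymbol{x}_0$ are given by $$\nabla_{\boldsymbol{x}}\psi(\boldsymbol{x}_0;\boldsymbol{u}) = 2[\mathsf{K},-\mathsf{K}]\,\mathrm{Im}\left(\mathrm{diag}(\overline{\boldsymbol{u}})\mathsf{Q}(\boldsymbol{x}_0)\boldsymbol{u}\right)$$ and $$\nabla^2_{\boldsymbol{x}}\psi(\boldsymbol{x}_0;\boldsymbol{u}) = 2[\mathsf{K},-\mathsf{K}]\bigg[\mathrm{diag}(\overline{\boldsymbol{u}})\mathsf{Q}(\boldsymbol{x}_0)\mathrm{diag}(\boldsymbol{u}) - \mathrm{Re}\left[\mathrm{diag}(\overline{\boldsymbol{u}})\mathrm{diag}(\mathsf{Q}(\boldsymbol{x}_0)\boldsymbol{u})\right]\bigg]\begin{bmatrix}\mathsf{K}^T\\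 -\mathsf{K}^T\end{bmatrix}.$$
   Context: For $\boldsymbol{x}\in\mathbb{R}^N$ and $\boldsymbol{u} = [\alpha_1,\ldots,\alpha_N,\beta_1,\ldots,\beta_N]^T\in\mathbb{C}^{2N}$, the pressure field is $p(\boldsymbol{x};\boldsymbol{u}) = \sum_{j=1}^N\alpha_j\exp[i\boldsymbol{k}_j\cdot\boldsymbol{x}]+\beta_j\exp[-i\boldsymbol{k}_j\cdot\boldsymbol{x}]$, and the acoustic radiation potential (ARP) is $$\psi(\boldsymbol{x};\boldsymbol{u}) = \begin{bmatrix}p\\ \nabla p\end{bmatrix}^*\mathsf{A}\begin{bmatrix}p\\ \nabla p\end{bmatrix} = \boldsymbol{u}^*\mathsf{Q}(\boldsymbol{x})\boldsymbol{u},\qquad \mathsf{Q}(\boldsymbol{x}) = \mathsf{M}(\boldsymbol{x})^*\mathsf{A}\mathsf{M}(\boldsymbol{x}),$$ where $\mathsf{M}(\boldsymbol{x}) = [\mathsf{M}_+(\boldsymbol{x})\ \ \mathsf{M}_-(\boldsymbol{x})]$ is the $(N+1)\times 2N$ matrix with $$\mathsf{M}_\pm(\boldsymbol{x}) = \begin{bmatrix}\exp[\pm i\boldsymbol{x}^T\mathsf{K}]\\ \pm i\mathsf{K}\,\mathrm{diag}(\exp[\pm i\boldsymbol{x}^T\mathsf{K}])\end{bmatrix}.$$ Here the exponential of a vector is taken entrywise (so $\exp[\pm i\boldsymbol{x}^T\mathsf{K}]$ is a row vector of length $N$), $\mathrm{diag}(\boldsymbol{a})$ is the diagonal matrix with the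 entries of $\boldsymbol{a}$ on its diagonal, $\overline{\boldsymbol{u}}$ is the entrywise complex conjugate, $^*$ is the conjugate transpose, and $\mathrm{Re}$, $\mathrm{Im}$ are taken entrywise.
   Formalization: The Hessian is stated as the entrywise real part of the whole printed right-hand side; as printed, with Re on the second term only, that matrix is Hermitian but can be non-real (N=2, K=I, A=diag(1,0,0), α=(1,i), β=0, x0=0 gives off-diagonal ±2i while the Hessian is 0). *)

theory Defs
  imports "HOL-Analysis.Analysis"
begin

text \<open>Index types: \<open>'n\<close> has \<open>N\<close> elements and indexes both the coordinates of space and the
  wavevectors; \<open>1 + 'n\<close> indexes the stacked vector \<open>[p; grad p]\<close>; \<open>'n + 'n\<close> indexes the
  amplitudes, with \<open>\<alpha>\<^sub>j = u $ Inl j\<close> and \<open>\<beta>\<^sub>j = u $ Inr j\<close>.\<close>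

definition hblock :: "'a^'n^'r \<Rightarrow> 'a^'m^'r \<Rightarrow> 'a^('n + 'm)^'r" where
  "hblock A B = (\<chi> i s. case s of Inl j \<Rightarrow> A $ i $ j | Inr j \<Rightarrow> B $ i $ j)"

definition vblock :: "'a^'c^'n \<Rightarrow> 'a^'c^'m \<Rightarrow> 'a^'c^('n + 'm)" where
  "vblock A B = (\<chi> s. case s of Inl j \<Rightarrow> A $ j | Inr j \<Rightarrow> B $ j)"

definition diag :: "'a::zero^'n \<Rightarrow> 'a^'n^'n" where
  "diag a = (\<chi> i j. if i = j then a $ i else 0)"

definition vcnj :: "complex^'n \<Rightarrow> complex^'n" where
  "vcnj u = (\<chi> i. cnj (u $ i))"

definition vIm :: "complex^'n \<Rightarrow> real^'n" where
  "vIm u = (\<chi> i. Im (u $ i))"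

abbreviation cmat :: "real^'n^'m \<Rightarrow> complex^'n^'m" where
  "cmat \<equiv> map_matrix complex_of_real"

definition ctranspose :: "complex^'n^'m \<Rightarrow> complex^'m^'n" where
  "ctranspose A = map_matrix cnj (transpose A)"

definition hermitian :: "complex^'n^'n \<Rightarrow> bool" where
  "hermitian A \<longleftrightarrow> ctranspose A = A"

text \<open>The sesquilinear product \<open>u\<^sup>* v\<close>.\<close>

definition cdot :: "complex^'n \<Rightarrow> complex^'n \<Rightarrow> complex" where
  "cdot u v = (\<Sum>i\<in>UNIV. cnj (u $ i) * v $ i)"

text \<open>The row \<open>exp[c x\<^sup>T K]\<close> as a vector; only \<open>c = \<plusminus>\<i>\<close> is used.\<close>

definition phase :: "complex \<Rightarrow> real^'n^'n \<Rightarrow> real^'n \<Rightarrow> complex^'n" where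
  "phase c K x = (\<chi> j. exp (c * of_real ((x v* K) $ j)))"

definition Mblock :: "complex \<Rightarrow> real^'n^'n \<Rightarrow> real^'n \<Rightarrow> complex^'n^(1 + 'n)" where
  "Mblock c K x =
     vblock (rowvector (phase c K x)) (map_matrix ((*) c) (cmat K ** diag (phase c K x)))"

definition Mmat :: "real^'n^'n \<Rightarrow> real^'n \<Rightarrow> complex^('n + 'n)^(1 + 'n)" where
  "Mmat K x = hblock (Mblock \<i> K x) (Mblock (- \<i>) K x)"

definition Qmat ::
  "complex^(1 + 'n)^(1 + 'n) \<Rightarrow> real^'n^'n \<Rightarrow> real^'n \<Rightarrow> complex^('n + 'n)^('n + 'n)" where
  "Qmat A K x = ctranspose (Mmat K x) ** A ** Mmat K x"

text \<open>For Hermitian \<open>A\<close> the number \<open>u\<^sup>* Q(x) u\<close> is real (lemma \<open>of_real_arp\<close> below); taking the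
  real part only gives \<open>arp\<close> the type needed for gradients. That it is the form
  \<open>[p; grad p]\<^sup>* A [p; grad p]\<close> in the pressure field is shown in \<open>arp_eq_field\<close>.\<close>

definition arp ::
  "complex^(1 + 'n)^(1 + 'n) \<Rightarrow> real^'n^'n \<Rightarrow> complex^('n + 'n) \<Rightarrow> real^'n \<Rightarrow> real" where
  "arp A K u x = Re (cdot u (Qmat A K x *v u))"

text \<open>\<open>H\<close> is the Hessian of \<open>f\<close> at \<open>x\<close>: the Jacobian matrix at \<open>x\<close> of the gradient field of
  \<open>f\<close>, which is required to exist in a neighbourhood of \<open>x\<close>.\<close>

definition has_hessian :: "(real^'n \<Rightarrow> real) \<Rightarrow> real^'n^'n \<Rightarrow> real^'n \<Rightarrow> bool" where
  "has_hessian f H x \<longleftrightarrow>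
     (\<exists>g. (\<forall>\<^sub>F y in nhds x. GDERIV f y :> g y) \<and> (g has_derivative (\<lambda>h. H *v h)) (at x))"

text \<open>Pitfall: without an outer \<open>Re\<close> the matrix
  \<open>2 [K, -K] (diag(cnj u) Q diag(u) - Re[diag(cnj u) diag(Q u)]) [K\<^sup>T; -K\<^sup>T]\<close>
  is Hermitian but in general not real, so it is not the Hessian of \<open>arp\<close>; its entrywise real
  part is. Example: \<open>N = 2\<close>, \<open>K = I\<close>, \<open>A = diag(1, 0, 0)\<close>, \<open>\<alpha> = (1, \<i>)\<close>, \<open>\<beta> = 0\<close>. Then
  \<open>\<psi>(x) = 2 - 2 sin(x\<^sub>2 - x\<^sub>1)\<close> has Hessian \<open>0\<close> at \<open>x = 0\<close>, whereas that matrix has the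
  off-diagonal entries \<open>2\<i>\<close> and \<open>-2\<i>\<close>.\<close>

definition pressure :: "('n \<Rightarrow> real^'n) \<Rightarrow> complex^('n + 'n) \<Rightarrow> real^'n \<Rightarrow> complex" where
  "pressure k u x =
     (\<Sum>j\<in>UNIV. u $ Inl j * exp (\<i> * of_real (k j \<bullet> x)) + u $ Inr j * exp (- \<i> * of_real (k j \<bullet> x)))"

lemma sum_UNIV_Plus:
  fixes f :: "'a::finite + 'b::finite \<Rightarrow> 'c::comm_monoid_add"
  shows "sum f UNIV = (\<Sum>j\<in>UNIV. f (Inl j)) + (\<Sum>j\<in>UNIV. f (Inr j))"
  by (simp add: sum.Plus flip: UNIV_Plus_UNIV)

lemma cdot_ctranspose: "cdot u (ctranspose B *v v) = cdot (B *v u) v"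
proof -
  have "cdot u (ctranspose B *v v) = (\<Sum>i\<in>UNIV. \<Sum>j\<in>UNIV. cnj (u $ i) * (cnj (B $ j $ i) * v $ j))"
    by (simp add: cdot_def ctranspose_def matrix_vector_mult_def transpose_def sum_distrib_left)
  also have "\<dots> = (\<Sum>j\<in>UNIV. \<Sum>i\<in>UNIV. cnj (u $ i) * (cnj (B $ j $ i) * v $ j))"
    by (rule sum.swap)
  also have "\<dots> = cdot (B *v u) v"
    by (simp add: cdot_def matrix_vector_mult_def sum_distrib_left sum_distrib_right mult_ac)
  finally show ?thesis .
qed

lemma cdot_commute: "cdot v u = cnj (cdot u v)"
  by (simp add: cdot_def mult.commute)

lemma ctranspose_mult: "ctranspose (A ** B) = ctranspose B ** ctranspose A"
  by (simp add: ctranspose_def matrix_matrix_mult_def transpose_def vec_eq_iff mult.commute)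

lemma ctranspose_ctranspose [simp]: "ctranspose (ctranspose A) = A"
  by (simp add: ctranspose_def transpose_def vec_eq_iff)

lemma hermitian_Qmat: "hermitian A \<Longrightarrow> hermitian (Qmat A K x)"
  by (simp add: hermitian_def Qmat_def ctranspose_mult matrix_mul_assoc)

lemma cdot_Qmat: "cdot u (Qmat A K x *v u) = cdot (Mmat K x *v u) (A *v (Mmat K x *v u))"
  by (simp add: Qmat_def cdot_ctranspose flip: matrix_vector_mul_assoc)

lemma of_real_arp:
  assumes "hermitian A"
  shows "of_real (arp A K u x) = cdot u (Qmat A K x *v u)"
proof -
  have "ctranspose (Qmat A K x) = Qmat A K x"
    using hermitian_Qmat[OF assms] by (simp add: hermitian_def)
  then have "cdot u (Qmat A K x *v u) = cnj (cdot u (Qmat A K x *v u))"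
    by (metis cdot_commute cdot_ctranspose)
  then show ?thesis
    unfolding arp_def by (metis Reals_cnj_iff of_real_Re)
qed

lemma Mmat_mult_Inl:
  assumes "K = (\<chi> i j. k j $ i)"
  shows "(Mmat K x *v u) $ Inl r = pressure k u x"
  by (simp add: assms Mmat_def Mblock_def hblock_def vblock_def rowvector_def phase_def
      pressure_def matrix_vector_mult_def sum_UNIV_Plus vector_matrix_mult_def inner_vec_def
      sum.distrib mult_ac)

lemma exp_inner_has_derivative:
  fixes k x :: "'a::real_inner" and c :: complex
  shows "((\<lambda>x. exp (c * of_real (k \<bullet> x))) has_derivative
          (\<lambda>h. exp (c * of_real (k \<bullet> x)) * (c * of_real (k \<bullet> h)))) (at x)"
proof -
  have "((\<lambda>x. c * of_real (k \<bullet> x)) has_derivative (\<lambda>h. c * of_real (k \<bullet> h))) (at x)"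
    by (intro has_derivative_mult_right has_derivative_of_real has_derivative_inner_right
        has_derivative_ident)
  then show ?thesis
    by (rule has_derivative_compose[OF _ has_field_derivative_imp_has_derivative[OF DERIV_exp]])
qed

lemma pressure_has_derivative:
  assumes "K = (\<chi> i j. k j $ i)"
  shows "(pressure k u has_derivative
           (\<lambda>h. \<Sum>a\<in>UNIV. of_real (h $ a) * (Mmat K x *v u) $ Inr a)) (at x)"
proof -
  have eq: "(Mmat K x *v u) $ Inr a =
     (\<Sum>j\<in>UNIV. \<i> * of_real (k j $ a) * (u $ Inl j * exp (\<i> * of_real (k j \<bullet> x))
        - u $ Inr j * exp (- \<i> * of_real (k j \<bullet> x))))" for a
    by (simp add: assms Mmat_def Mblock_def hblock_def vblock_def phase_def diag_def
        matrix_vector_mult_def matrix_matrix_mult_def sum_UNIV_Plus vector_matrix_mult_def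
        inner_vec_def if_distrib cong: if_cong)
      (simp add: algebra_simps sum.distrib sum_subtractf sum_negf)
  have "(\<Sum>a\<in>UNIV. of_real (h $ a) * (Mmat K x *v u) $ Inr a) =
     (\<Sum>j\<in>UNIV. u $ Inl j * (exp (\<i> * of_real (k j \<bullet> x)) * (\<i> * of_real (k j \<bullet> h)))
        + u $ Inr j * (exp (- \<i> * of_real (k j \<bullet> x)) * (- \<i> * of_real (k j \<bullet> h))))" for h
    unfolding eq sum_distrib_left
    by (subst sum.swap, rule sum.cong)
      (simp_all add: inner_vec_def sum_distrib_left sum_distrib_right algebra_simps sum_subtractf sum_negf)
  then show ?thesis
    unfolding pressure_def
    by (simp only:) (intro has_derivative_sum has_derivative_add has_derivative_mult_right
        exp_inner_has_derivative)
qed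

lemma arp_eq_field:
  assumes "hermitian A" and "K = (\<chi> i j. k j $ i)"
    and "(pressure k u has_derivative (\<lambda>h. \<Sum>a\<in>UNIV. of_real (h $ a) * dp $ a)) (at x)"
    and "w = (\<chi> s. case s of Inl r \<Rightarrow> pressure k u x | Inr a \<Rightarrow> dp $ a)"
  shows "of_real (arp A K u x) = cdot w (A *v w)"
proof -
  have "(\<Sum>a\<in>UNIV. of_real (h $ a) * dp $ a) = (\<Sum>a\<in>UNIV. of_real (h $ a) * (Mmat K x *v u) $ Inr a)"
    for h
    using has_derivative_unique[OF assms(3) pressure_has_derivative[OF assms(2)]] by metis
  from this[of "axis b 1" for b] have "dp $ b = (Mmat K x *v u) $ Inr b" for b
    by (simp add: axis_def if_distrib if_distribR cong: if_cong)
  then have "w = Mmat K x *v u"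
    by (auto simp: assms(4) vec_eq_iff Mmat_mult_Inl[OF assms(2)] split: sum.split)
  then show ?thesis
    using assms(1) by (simp add: of_real_arp cdot_Qmat)
qed

end

theory Submission
  imports Defs
begin

text \<open>Let \<open>\<kappa>\<^sub>s\<close> be the columns of \<open>[K, -K]\<close>. The entries of \<open>Q\<close> depend on \<open>x\<close> only through a
  phase, \<open>Q(x)\<^sub>s\<^sub>t = exp(\<i> (\<kappa>\<^sub>t - \<kappa>\<^sub>s) \<cdot> x) Q(0)\<^sub>s\<^sub>t\<close>, so differentiating in direction \<open>h\<close> multiplies
  the entry by \<open>\<i> (\<kappa>\<^sub>t - \<kappa>\<^sub>s) \<cdot> h\<close>. Summing over \<open>s\<close> and \<open>t\<close>, and using that \<open>Q\<close> is Hermitian to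
  exchange them, gives the gradient; differentiating the gradient gives the Hessian.\<close>

text \<open>At the origin every phase is 1, so \<open>Mmat K 0\<close> holds the constant
  coefficients. Entry \<open>s\<close> of \<open>x v* hblock K (- K)\<close> is
  \<open>\<kappa>\<^sub>s \<bullet> x\<close>, which covers both blocks of M with a single sign
  convention.\<close>

lemma Mmat_eq_phase:
  "Mmat K x $ r $ s = exp (\<i> * of_real ((x v* hblock K (- K)) $ s)) * Mmat K 0 $ r $ s"
  by (cases r; cases s)
    (simp_all add: Mmat_def Mblock_def hblock_def vblock_def rowvector_def phase_def diag_def
      matrix_matrix_mult_def vector_matrix_mult_def if_distrib sum_negf cong: if_cong)

lemma Qmat_nth:
  "Qmat A K x $ s $ t =
     (\<Sum>b\<in>UNIV. (\<Sum>a\<in>UNIV. cnj (Mmat K x $ a $ s) * A $ a $ b) * Mmat K x $ b $ t)"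
  by (simp add: Qmat_def matrix_matrix_mult_def ctranspose_def transpose_def)

lemma Qmat_eq_phase:
  "Qmat A K x $ s $ t =
     exp (\<i> * of_real ((x v* hblock K (- K)) $ t - (x v* hblock K (- K)) $ s)) * Qmat A K 0 $ s $ t"
  \<comment> \<open>Fixing the point \<open>x\<close> keeps the rule from rewriting the
    \<open>Mmat K 0\<close> that it produces. The left factor is conjugated, hence the minus sign at
    \<open>s\<close>.\<close>
  unfolding Qmat_nth Mmat_eq_phase[of K x]
  by (simp add: sum_distrib_left sum_distrib_right exp_cnj right_diff_distrib exp_diff exp_minus
      divide_inverse mult_ac)

lemma Qmat_has_derivative:
  "((\<lambda>x. Qmat A K x $ s $ t) has_derivative
     (\<lambda>h. \<i> * of_real ((h v* hblock K (- K)) $ t - (h v* hblock K (- K)) $ s) * Qmat A K x $ s $ t))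
   (at x)"
proof -
  \<comment> \<open>\<open>d\<close> is \<open>\<kappa>\<^sub>t - \<kappa>\<^sub>s\<close>; it turns
    the exponent into the inner product that \<open>exp_inner_has_derivative\<close>
    expects.\<close>
  define d where "d = column t (hblock K (- K)) - column s (hblock K (- K))"
  have d: "(y v* hblock K (- K)) $ t - (y v* hblock K (- K)) $ s = d \<bullet> y" for y
    by (simp add: d_def vector_matrix_mult_def column_def inner_vec_def sum_subtractf algebra_simps)
  have Q: "(\<lambda>x. Qmat A K x $ s $ t) = (\<lambda>x. exp (\<i> * of_real (d \<bullet> x)) * Qmat A K 0 $ s $ t)"
    by (rule ext, subst Qmat_eq_phase) (simp only: d)
  have "((\<lambda>x. exp (\<i> * of_real (d \<bullet> x)) * Qmat A K 0 $ s $ t) has_derivative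
      (\<lambda>h. exp (\<i> * of_real (d \<bullet> x)) * (\<i> * of_real (d \<bullet> h)) * Qmat A K 0 $ s $ t)) (at x)"
    by (intro has_derivative_mult_left exp_inner_has_derivative)
  then show ?thesis
    by (subst (1 2) Q[THEN fun_cong], simp only: d mult_ac)
qed

lemma diag_mult_vec_nth [simp]: "(diag a *v v) $ i = a $ i * v $ i"
  for a :: "'a::semiring_1^'n"
  by (simp add: diag_def matrix_vector_mult_def if_distribR if_distrib cong: if_cong)

lemma diag_mult_nth [simp]: "(diag a ** B) $ i $ j = a $ i * B $ i $ j"
  for a :: "'a::semiring_1^'n"
  by (simp add: diag_def matrix_matrix_mult_def if_distribR if_distrib cong: if_cong)

lemma mult_diag_nth [simp]: "(B ** diag a) $ i $ j = B $ i $ j * a $ j"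
  for a :: "'a::semiring_1^'n"
  by (simp add: diag_def matrix_matrix_mult_def if_distribR if_distrib cong: if_cong)

text \<open>Real factors commute with the entrywise real part. This rule and the next bring the
  outer \<open>Re\<close> of the Hessian to the inner matrix.\<close>

lemma map_matrix_Re_cmat_mult: "map_matrix Re (cmat B ** P) = B ** map_matrix Re P"
  by (simp add: vec_eq_iff matrix_matrix_mult_def)

lemma map_matrix_Re_mult_cmat: "map_matrix Re (P ** cmat B) = map_matrix Re P ** B"
  by (simp add: vec_eq_iff matrix_matrix_mult_def)

lemma map_matrix_Re_diag_mult_diag:
  "(map_matrix Re (diag a ** diag b) *v y) $ s = Re ((diag a *v b) $ s) * y $ s"
  unfolding matrix_vector_mult_def[of "map_matrix _ _"]
  by (simp add: diag_def[of b] if_distribR if_distrib cong: if_cong)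

lemma vblock_transpose: "vblock (transpose A) (transpose B) = transpose (hblock A B)"
  by (auto simp: vec_eq_iff vblock_def hblock_def transpose_def split: sum.split)

lemma transpose_minus: "transpose (- A) = - transpose A"
  by (simp add: vec_eq_iff transpose_def)

text \<open>These are the summands of \<open>cdot u (Qmat A K x *v u)\<close>: their real parts add
  up to \<open>arp\<close>, and the imaginary parts of the row sums over \<open>t\<close> form the
  vector in the gradient formula.\<close>

abbreviation (input) Qterm where
  "Qterm A K u x s t \<equiv> cnj (u $ s) * Qmat A K x $ s $ t * u $ t"

lemma arp_eq_sum: "arp A K u x = (\<Sum>s\<in>UNIV. \<Sum>t\<in>UNIV. Re (Qterm A K u x s t))"
  by (simp add: arp_def cdot_def matrix_vector_mult_def sum_distrib_left mult.assoc
      del: times_complex.sel)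

lemma Qterm_has_derivative:
  "((\<lambda>x. Qterm A K u x s t) has_derivative
     (\<lambda>h. \<i> * of_real ((h v* hblock K (- K)) $ t - (h v* hblock K (- K)) $ s) * Qterm A K u x s t))
   (at x)"
proof -
  have "((\<lambda>x. Qterm A K u x s t) has_derivative
     (\<lambda>h. cnj (u $ s) * (\<i> * of_real ((h v* hblock K (- K)) $ t - (h v* hblock K (- K)) $ s) *
        Qmat A K x $ s $ t) * u $ t)) (at x)"
    by (intro has_derivative_mult_left has_derivative_mult_right Qmat_has_derivative)
  then show ?thesis
    by (simp add: mult_ac)
qed

lemma Re_of_real_mult: "Re (of_real r * z) = r * Re z"
  by simp

lemma Im_of_real_mult: "Im (of_real r * z) = r * Im z"
  by simp

text \<open>Since Re(i r z) = - r Im z for real r, the roles of \<open>s\<close> and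
  \<open>t\<close> in the difference are exchanged; for the imaginary part below, Im(i r z) = r Re z
  keeps them.\<close>

lemma Re_Qterm_has_derivative:
  "((\<lambda>x. Re (Qterm A K u x s t)) has_derivative
     (\<lambda>h. ((h v* hblock K (- K)) $ s - (h v* hblock K (- K)) $ t) * Im (Qterm A K u x s t))) (at x)"
  using has_derivative_Re[OF Qterm_has_derivative[
    where A = A and K = K and u = u and s = s and t = t and x = x]]
  by (simp only: mult.assoc Re_i_times Im_of_real_mult)
    (simp add: left_diff_distrib del: times_complex.sel)

lemma Im_Qterm_has_derivative:
  "((\<lambda>x. Im (Qterm A K u x s t)) has_derivative
     (\<lambda>h. ((h v* hblock K (- K)) $ t - (h v* hblock K (- K)) $ s) * Re (Qterm A K u x s t))) (at x)"
  using has_derivative_Im[OF Qterm_has_derivative[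
    where A = A and K = K and u = u and s = s and t = t and x = x]]
  by (simp only: mult.assoc Im_i_times Re_of_real_mult)

text \<open>Q inherits being Hermitian from A. Hence the imaginary parts of the terms are
  antisymmetric in \<open>s\<close> and \<open>t\<close>.\<close>

lemma cnj_Qterm:
  assumes "hermitian A"
  shows "cnj (Qterm A K u x s t) = Qterm A K u x t s"
proof -
  have "ctranspose (Qmat A K x) $ t $ s = Qmat A K x $ t $ s"
    using hermitian_Qmat[OF assms, of K x] by (simp add: hermitian_def)
  then have "cnj (Qmat A K x $ s $ t) = Qmat A K x $ t $ s"
    by (simp add: ctranspose_def transpose_def)
  then show ?thesis
    by (simp add: mult_ac)
qed

lemma diag_Qmat_vec_nth:
  "(diag (vcnj u) *v (Qmat A K x *v u)) $ s = (\<Sum>t\<in>UNIV. Qterm A K u x s t)"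
  by (simp only: diag_mult_vec_nth)
    (simp add: vcnj_def matrix_vector_mult_def sum_distrib_left mult.assoc)

lemma GDERIV_arp:
  assumes "hermitian A"
  shows "GDERIV (arp A K u) x :>
    2 *\<^sub>R (hblock K (- K) *v vIm (diag (vcnj u) *v (Qmat A K x *v u)))"
proof -
  define w where "w h = h v* hblock K (- K)" for h
  define c where "c s t = Im (Qterm A K u x s t)" for s t
  have c: "c t s = - c s t" for s t
    unfolding c_def cnj_Qterm[OF assms, where K = K and x = x and u = u and s = s and t = t, symmetric]
      by (rule cnj.sel(2))
  \<comment> \<open>Swapping the summation indices and using the antisymmetry of \<open>c\<close>
    makes the two halves of the derivative equal: this is the factor 2 of the gradient.\<close>
  have "(\<Sum>s\<in>UNIV. \<Sum>t\<in>UNIV. w h $ t * c s t) = - (\<Sum>s\<in>UNIV. \<Sum>t\<in>UNIV. w h $ s * c s t)" for h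
    unfolding sum_negf[symmetric] mult_minus_right[symmetric] c[symmetric] by (rule sum.swap)
  then have "(\<Sum>s\<in>UNIV. \<Sum>t\<in>UNIV. (w h $ s - w h $ t) * c s t) =
      h \<bullet> (2 *\<^sub>R (hblock K (- K) *v vIm (diag (vcnj u) *v (Qmat A K x *v u))))" for h
    \<comment> \<open>The matrix moves to the other side of the inner product, where it turns
      \<open>h\<close> into \<open>w h\<close>.\<close>
    by (simp only: inner_scaleR_right dot_lmul_matrix[symmetric] w_def[symmetric])
      (simp add: left_diff_distrib sum_subtractf inner_vec_def[of "w h"] vIm_def diag_Qmat_vec_nth
        sum_distrib_left c_def del: times_complex.sel diag_mult_vec_nth)
  moreover have "(arp A K u has_derivative (\<lambda>h. \<Sum>s\<in>UNIV. \<Sum>t\<in>UNIV. (w h $ s - w h $ t) * c s t)) (at x)"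
    unfolding arp_eq_sum w_def c_def
    by (intro has_derivative_sum Re_Qterm_has_derivative)
  ultimately show ?thesis
    by (simp add: gderiv_def)
qed

text \<open>Differentiating row sum \<open>s\<close> gives weights \<open>w h $ t - w h $ s\<close>.
  The part with \<open>t\<close> is a full matrix applied to \<open>w h\<close>; in the part with
  \<open>s\<close> the weight leaves the sum, so the row sum becomes a diagonal entry. This is the
  source of the two terms of the Hessian.\<close>

lemma gradient_arp_has_derivative:
  "((\<lambda>x. 2 *\<^sub>R (hblock K (- K) *v vIm (diag (vcnj u) *v (Qmat A K x *v u)))) has_derivative
     (\<lambda>h. 2 *\<^sub>R (hblock K (- K) *v ((map_matrix Re (diag (vcnj u) ** Qmat A K x ** diag u)
       - map_matrix Re (diag (vcnj u) ** diag (Qmat A K x *v u))) *v (h v* hblock K (- K)))))) (at x)"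
proof -
  define w where "w h = h v* hblock K (- K)" for h
  have "((\<lambda>x. vIm (diag (vcnj u) *v (Qmat A K x *v u)) $ s) has_derivative
      (\<lambda>h. \<Sum>t\<in>UNIV. (w h $ t - w h $ s) * Re (Qterm A K u x s t))) (at x)" for s
    unfolding vIm_def diag_Qmat_vec_nth w_def
    by (simp del: times_complex.sel) (intro has_derivative_sum Im_Qterm_has_derivative)
  moreover have "(\<Sum>t\<in>UNIV. (w h $ t - w h $ s) * Re (Qterm A K u x s t)) =
      ((map_matrix Re (diag (vcnj u) ** Qmat A K x ** diag u)
       - map_matrix Re (diag (vcnj u) ** diag (Qmat A K x *v u))) *v w h) $ s" for h s
  proof -
    have "(map_matrix Re (diag (vcnj u) ** Qmat A K x ** diag u) *v w h) $ s =
        (\<Sum>t\<in>UNIV. w h $ t * Re (Qterm A K u x s t))"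
      by (simp add: matrix_vector_mult_def vcnj_def mult.commute del: times_complex.sel)
    moreover have "(map_matrix Re (diag (vcnj u) ** diag (Qmat A K x *v u)) *v w h) $ s =
        w h $ s * (\<Sum>t\<in>UNIV. Re (Qterm A K u x s t))"
      by (simp add: map_matrix_Re_diag_mult_diag diag_Qmat_vec_nth mult.commute
          del: times_complex.sel diag_mult_vec_nth)
    ultimately show ?thesis
      by (simp add: matrix_vector_mult_diff_rdistrib left_diff_distrib sum_subtractf
          sum_distrib_left del: times_complex.sel)
  qed
  ultimately have "((\<lambda>x. vIm (diag (vcnj u) *v (Qmat A K x *v u))) has_derivative
     (\<lambda>h. (map_matrix Re (diag (vcnj u) ** Qmat A K x ** diag u)
       - map_matrix Re (diag (vcnj u) ** diag (Qmat A K x *v u))) *v w h)) (at x)"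
    by (subst has_derivative_componentwise_within) (auto simp: Basis_vec_def inner_axis)
  then show ?thesis
    unfolding w_def
    by (intro has_derivative_scaleR_right
        bounded_linear.has_derivative[OF matrix_vector_mul_bounded_linear])
qed

theorem theorem3p1:
  fixes k :: "'n::finite \<Rightarrow> real^'n" and K :: "real^'n^'n"
    and A :: "complex^(1 + 'n)^(1 + 'n)" and u :: "complex^('n + 'n)" and x0 :: "real^'n"
  assumes "\<And>i j. norm (k i) = norm (k j)"
    and "K = (\<chi> i j. k j $ i)"
    and "hermitian A"
  shows "GDERIV (arp A K u) x0 :>
           2 *\<^sub>R (hblock K (- K) *v vIm (diag (vcnj u) *v (Qmat A K x0 *v u)))
       \<and> has_hessian (arp A K u)
           (map_matrix Re
             (2 *\<^sub>R (cmat (hblock K (- K)) **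
               (diag (vcnj u) ** Qmat A K x0 ** diag u
                 - cmat (map_matrix Re (diag (vcnj u) ** diag (Qmat A K x0 *v u)))) **
               cmat (vblock (transpose K) (- transpose K)))))
           x0"
proof
  show "GDERIV (arp A K u) x0 :>
      2 *\<^sub>R (hblock K (- K) *v vIm (diag (vcnj u) *v (Qmat A K x0 *v u)))"
    by (rule GDERIV_arp) fact
next
  let ?P = "diag (vcnj u) ** Qmat A K x0 ** diag u"
  let ?R = "map_matrix Re (diag (vcnj u) ** diag (Qmat A K x0 *v u))"
  have "map_matrix Re (2 *\<^sub>R (cmat (hblock K (- K)) ** (?P - cmat ?R) **
      cmat (vblock (transpose K) (- transpose K)))) =
    2 *\<^sub>R map_matrix Re (cmat (hblock K (- K)) ** (?P - cmat ?R) **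
      cmat (vblock (transpose K) (- transpose K)))"
    by (simp add: vec_eq_iff)
  also have "\<dots> = 2 *\<^sub>R (hblock K (- K) ** (map_matrix Re (?P - cmat ?R)) **
      transpose (hblock K (- K)))"
    by (simp only: map_matrix_Re_cmat_mult map_matrix_Re_mult_cmat vblock_transpose
        flip: transpose_minus)
  \<comment> \<open>The diagonal term is real already, so the outer real part changes only
    \<open>?P\<close>.\<close>
  also have "map_matrix Re (?P - cmat ?R) = map_matrix Re ?P - ?R"
    by (simp add: vec_eq_iff)
  finally have eq: "map_matrix Re (2 *\<^sub>R (cmat (hblock K (- K)) ** (?P - cmat ?R) **
        cmat (vblock (transpose K) (- transpose K)))) *v h =
      2 *\<^sub>R (hblock K (- K) *v ((map_matrix Re ?P - ?R) *v (h v* hblock K (- K))))" for h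
    by (simp only: scaleR_matrix_vector_assoc[symmetric] matrix_vector_mul_assoc[symmetric]
        transpose_matrix_vector)
  show "has_hessian (arp A K u)
      (map_matrix Re (2 *\<^sub>R (cmat (hblock K (- K)) ** (?P - cmat ?R) **
        cmat (vblock (transpose K) (- transpose K))))) x0"
    \<comment> \<open>The gradient formula holds at every point, so it supplies both the witness
      field and the neighbourhood condition.\<close>
    unfolding has_hessian_def eq
    by (rule exI, rule conjI, rule always_eventually, rule allI, rule GDERIV_arp[OF assms(3)],
        rule gradient_arp_has_derivative)
qed

end
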